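(* For all integers $\ell\ge 0$ and $m\ge \ell+1$, $$\frac{d_\ell^2(m)}{d_\ell(m-1)\,d_\ell(m+1)} > \frac{(m-\ell+1)m^3}{(m-\ell)(m+1)(m^2+1)}.$$
   Context: For integers $0\le \ell\le m$, the Boros-Moll numbers are $$d_\ell(m)=2^{-2m}\sum_{k=\ell}^m 2^k \binom{2m-2k}{m-k}\binom{m+k}{k}\binom{k}{\ell},$$ and $d_\ell^2(m)$ denotes $(d_\ell(m))^2$. *)

theory Defs
  imports Complex_Main
begin

text \<open>
  The sum is empty, so the value is 0, when \<open>m < l\<close>.
\<close>

definition boros_moll :: "nat \<Rightarrow> nat \<Rightarrow> real" where
  "boros_moll l m =
    (\<Sum>k=l..m. 2 ^ k * real ((2 * m - 2 * k) choose (m - k)) * real ((m + k) choose k)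
      * real (k choose l)) / 2 ^ (2 * m)"

end

theory Submission
  imports Defs
begin

text \<open>
  Creative telescoping gives a three-term recurrence in \<open>m\<close> for fixed \<open>l\<close>.  For
  \<open>Y\<^sub>m = 2 (m - l) m d\<^sub>l(m) / d\<^sub>l(m - 1)\<close> it becomes \<open>Y\<^sub>m\<^sub>+\<^sub>1 = A\<^sub>m - B\<^sub>m / Y\<^sub>m\<close> with \<open>B\<^sub>m \<ge> 0\<close>, a map
  increasing in \<open>Y\<^sub>m\<close>, so a lower bound on \<open>Y\<^sub>m\<close> propagates by induction.  The claim reads
  \<open>m\<^sup>4 Y\<^sub>m\<^sub>+\<^sub>1 < (m + 1)\<^sup>2 (m\<^sup>2 + 1) Y\<^sub>m\<close>; eliminating \<open>Y\<^sub>m\<^sub>+\<^sub>1\<close> turns it into a quadratic inequality in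
  \<open>Y\<^sub>m\<close> whose left-hand side is increasing in the relevant range, so it suffices to check it at
  the lower bound.
\<close>

section \<open>Summand of the Boros-Moll numbers and its term ratios\<close>

definition bm_term :: "nat \<Rightarrow> nat \<Rightarrow> nat \<Rightarrow> real" where
  "bm_term l m k = 2 ^ k * real ((2 * m - 2 * k) choose (m - k)) * real ((m + k) choose k)
      * real (k choose l) / 4 ^ m"

text \<open>Terms with \<open>k < l\<close> vanish, so the summation can start at 0 whatever
  \<open>l\<close> is.\<close>

lemma boros_moll_eq_sum: "boros_moll l m = (\<Sum>k\<le>m. bm_term l m k)"
proof -
  have "(\<Sum>k\<le>m. bm_term l m k) = (\<Sum>k=l..m. bm_term l m k)"
    by (rule sum.mono_neutral_right) (auto simp: bm_term_def not_le)
  thus ?thesis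
    by (simp add: boros_moll_def bm_term_def sum_divide_distrib power_mult)
qed

lemma central_binomial_Suc:
  "(real j + 1) * real ((2 * Suc j) choose Suc j) = 2 * (2 * real j + 1) * real ((2 * j) choose j)"
proof -
  have "Suc j * ((2 * Suc j) choose Suc j) = (2 * Suc j) * ((Suc (2 * j)) choose j)"
    using Suc_times_binomial_eq[of "Suc (2 * j)" j] by (simp add: mult.commute)
  hence 1: "(2 * Suc j) choose Suc j = 2 * ((Suc (2 * j)) choose j)"
    by (metis (no_types, lifting) mult.assoc mult.commute mult_cancel1 nat.distinct(1))
  have "(Suc (2 * j) - j) * (Suc (2 * j) choose j) = Suc (2 * j) * ((2 * j) choose j)"
    using binomial_absorb_comp[of "Suc (2 * j)" j] by simp
  hence "Suc j * (Suc (2 * j) choose j) = Suc (2 * j) * ((2 * j) choose j)"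
    by (simp add: Suc_diff_le mult_2 del: mult_Suc mult_Suc_right binomial_Suc_Suc)
  hence "(real j + 1) * real (Suc (2 * j) choose j) = (2 * real j + 1) * real ((2 * j) choose j)"
    by (metis (mono_tags, lifting) of_nat_mult of_nat_Suc of_nat_numeral add.commute)
  thus ?thesis
    unfolding 1 by (simp add: algebra_simps)
qed

lemma binomial_upper_Suc:
  "(real k + 1 - real l) * real (Suc k choose l) = (real k + 1) * real (k choose l)"
proof (cases "l \<le> Suc k")
  case True
  have "(Suc k - l) * (Suc k choose l) = Suc k * (k choose l)"
    using binomial_absorb_comp[of "Suc k" l] by simp
  hence "real (Suc k - l) * real (Suc k choose l) = real (Suc k) * real (k choose l)"
    by (metis of_nat_mult)
  with True show ?thesis
    by (simp add: of_nat_diff add.commute)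
qed (simp add: binomial_eq_0)

lemma binomial_add_Suc:
  "(real m + 1) * real ((Suc m + k) choose k) = (real m + real k + 1) * real ((m + k) choose k)"
  using binomial_upper_Suc[of "m + k" k] by (simp add: algebra_simps)

lemma binomial_add_Suc':
  "(real k + 1) * real ((m + Suc k) choose Suc k) = (real m + real k + 1) * real ((m + k) choose k)"
  using arg_cong[OF Suc_times_binomial_eq[of "m + k" k], of real]
  by (simp add: algebra_simps)

text \<open>With \<open>j = m - k\<close>, the ratio collects
  \<open>2 * (2 * j + 1) / (j + 1)\<close> from the central binomial,
  \<open>(m + k + 1) / (m + 1)\<close> from the other one and 1/4 from the power of 4.\<close>

lemma bm_term_Suc_m:
  assumes "k \<le> m"
  shows "2 * (real m - real k + 1) * (real m + 1) * bm_term l (Suc m) k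
    = (2 * (real m - real k) + 1) * (real m + real k + 1) * bm_term l m k"
proof -
  obtain j where m: "m = k + j"
    using assms le_iff_add by blast
  define c where "c = 2 ^ k * real (k choose l) / 4 ^ m"
  have j: "2 * m - 2 * k = 2 * j" "m - k = j" "2 * Suc m - 2 * k = 2 * Suc j" "Suc m - k = Suc j"
    by (simp_all add: m)
  have F': "bm_term l (Suc m) k = c / 4 * real ((2 * Suc j) choose Suc j) * real ((Suc m + k) choose k)"
    unfolding bm_term_def c_def j by (simp add: mult_ac del: binomial_Suc_Suc mult_Suc_right)
  have F: "bm_term l m k = c * real ((2 * j) choose j) * real ((m + k) choose k)"
    unfolding bm_term_def c_def j by simp
  have "2 * (real m - real k + 1) * (real m + 1) * bm_term l (Suc m) k
      = c / 2 * ((real j + 1) * real ((2 * Suc j) choose Suc j))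
        * ((real m + 1) * real ((Suc m + k) choose k))"
    unfolding F' by (simp add: m algebra_simps del: binomial_Suc_Suc mult_Suc_right)
  also have "\<dots> = (2 * (real m - real k) + 1) * (real m + real k + 1) * bm_term l m k"
    unfolding central_binomial_Suc binomial_add_Suc F by (simp add: m)
  finally show ?thesis .
qed

lemma bm_term_Suc_k:
  assumes "k < m"
  shows "(2 * (real m - real k) - 1) * (real k + 1 - real l) * bm_term l m (Suc k)
    = (real m - real k) * (real m + real k + 1) * bm_term l m k"
proof -
  obtain j where m: "m = Suc (k + j)"
    using assms less_iff_Suc_add by blast
  define c where "c = 2 ^ k / (4 ^ m :: real)"
  have j: "2 * m - 2 * Suc k = 2 * j" "m - Suc k = j" "2 * m - 2 * k = 2 * Suc j" "m - k = Suc j"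
    by (simp_all add: m)
  have F': "bm_term l m (Suc k)
      = 2 * c * real ((2 * j) choose j) * real ((m + Suc k) choose Suc k) * real (Suc k choose l)"
    unfolding bm_term_def c_def j by simp
  have F: "bm_term l m k
      = c * real ((2 * Suc j) choose Suc j) * real ((m + k) choose k) * real (k choose l)"
    unfolding bm_term_def c_def j by simp
  \<comment> \<open>The extra factor \<open>k + 1\<close> is what \<open>binomial_add_Suc'\<close>
    consumes; \<open>binomial_upper_Suc\<close> gives it back, so it cancels at the end.\<close>
  have "(real k + 1) * ((2 * (real m - real k) - 1) * (real k + 1 - real l) * bm_term l m (Suc k))
      = c * (2 * (2 * real j + 1) * real ((2 * j) choose j))
        * ((real k + 1) * real ((m + Suc k) choose Suc k))
        * ((real k + 1 - real l) * real (Suc k choose l))"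
    unfolding F' by (simp add: m)
  also have "\<dots> = (real k + 1) * ((real m - real k) * (real m + real k + 1) * bm_term l m k)"
    unfolding central_binomial_Suc[symmetric] binomial_add_Suc' binomial_upper_Suc F
    by (simp add: m)
  finally show ?thesis
    by (metis mult_cancel_left of_nat_Suc of_nat_eq_0_iff nat.distinct(1) add.commute)
qed

text \<open>The top term of row \<open>m + 1\<close> has no counterpart with the same
  \<open>k\<close> in row \<open>m\<close>, so it is reached along the diagonal, where the central
  binomial is 1.\<close>

lemma bm_term_diag:
  "(real m + 1 - real l) * bm_term l (Suc m) (Suc m) = (2 * real m + 1) * bm_term l m m"
proof -
  have "(real m + 1 - real l) * bm_term l (Suc m) (Suc m)
      = 2 ^ m / (2 * 4 ^ m) * real ((2 * Suc m) choose Suc m)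
        * ((real m + 1 - real l) * real (Suc m choose l))"
    unfolding bm_term_def mult_2[symmetric] by (simp del: binomial_Suc_Suc mult_Suc_right)
  also have "\<dots> = 2 ^ m / (2 * 4 ^ m) * ((real m + 1) * real ((2 * Suc m) choose Suc m))
        * real (m choose l)"
    unfolding binomial_upper_Suc by simp
  also have "\<dots> = (2 * real m + 1) * bm_term l m m"
    unfolding central_binomial_Suc bm_term_def mult_2[symmetric] by (simp add: field_simps)
  finally show ?thesis .
qed

section \<open>Creative telescoping and the three-term recurrence\<close>

text \<open>This is the operator of \<open>boros_moll_recurrence\<close>, all terms on one side,
  applied to the summand instead of the sum.\<close>

definition telescoper :: "nat \<Rightarrow> nat \<Rightarrow> nat \<Rightarrow> real" where
  "telescoper l m k =
     4 * (real m + 2 - real l) * (real m + 1) * (real m + 2) * bm_term l (Suc (Suc m)) k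
     - 2 * (real m + 1) * (8 * real m ^ 2 + 24 * real m + 19 - 4 * real l ^ 2) * bm_term l (Suc m) k
     + (real m + real l + 1) * (4 * real m + 3) * (4 * real m + 5) * bm_term l m k"

text \<open>
  The Zeilberger certificate: \<open>telescoper l m k = G (k + 1) - G k\<close> with
  \<open>G k = (k - l) (2 j + 1) cert l m (j + 2) / ((j + 1) (j + 2)) * bm_term l m k\<close>, \<open>j = m - k\<close>, for \<open>k < m\<close>.
\<close>

definition cert :: "real \<Rightarrow> real \<Rightarrow> real \<Rightarrow> real" where
  "cert l m i = (2 * m + 4) * (2 * m + 3) - 2 * (5 * m + 7 - l * (4 * m + 5)) * i
     + 2 * (m + 2 - l) * i * (2 * i - 1)"

text \<open>By \<open>bm_term_Suc_m\<close> all three terms are rational multiples of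
  \<open>bm_term l m k\<close>, which leaves a polynomial identity. The right-hand side is
  \<open>G (k + 1) - G k\<close> times \<open>(j + 1) * (j + 2)\<close>, with
  \<open>G (k + 1)\<close> moved back to \<open>bm_term l m k\<close> by
  \<open>bm_term_Suc_k\<close>.\<close>

lemma telescoper_eq:
  fixes j :: real
  assumes "k \<le> m"
  defines "j \<equiv> real m - real k"
  shows "(j + 1) * (j + 2) * telescoper l m k
    = (cert l m (j + 1) * (real m + real k + 1) * (j + 2)
       - (real k - real l) * (2 * j + 1) * cert l m (j + 2)) * bm_term l m k"
proof -
  have k: "real k = real m - j"
    by (simp add: j_def)
  have 1: "2 * (j + 1) * (real m + 1) * bm_term l (Suc m) k
      = (2 * j + 1) * (real m + real k + 1) * bm_term l m k"
    using bm_term_Suc_m[OF assms(1)] by (simp add: j_def)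
  have 2: "2 * (j + 2) * (real m + 2) * bm_term l (Suc (Suc m)) k
      = (2 * j + 3) * (real m + real k + 2) * bm_term l (Suc m) k"
    using bm_term_Suc_m[of k "Suc m" l] assms(1) by (simp add: j_def algebra_simps)
  have "(j + 1) * (j + 2) * telescoper l m k
      = (real m + 2 - real l) * (2 * (j + 1) * (real m + 1))
          * (2 * (j + 2) * (real m + 2) * bm_term l (Suc (Suc m)) k)
        - (8 * real m ^ 2 + 24 * real m + 19 - 4 * real l ^ 2) * (j + 2)
          * (2 * (j + 1) * (real m + 1) * bm_term l (Suc m) k)
        + (real m + real l + 1) * (4 * real m + 3) * (4 * real m + 5) * (j + 1) * (j + 2)
          * bm_term l m k"
    unfolding telescoper_def by algebra
  also have "\<dots> = (real m + 2 - real l) * (2 * j + 3) * (real m + real k + 2)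
          * (2 * (j + 1) * (real m + 1) * bm_term l (Suc m) k)
        - (8 * real m ^ 2 + 24 * real m + 19 - 4 * real l ^ 2) * (j + 2)
          * (2 * (j + 1) * (real m + 1) * bm_term l (Suc m) k)
        + (real m + real l + 1) * (4 * real m + 3) * (4 * real m + 5) * (j + 1) * (j + 2)
          * bm_term l m k"
    unfolding 2 by algebra
  also have "\<dots> = ((real m + 2 - real l) * (2 * j + 3) * (real m + real k + 2)
          * (2 * j + 1) * (real m + real k + 1)
        - (8 * real m ^ 2 + 24 * real m + 19 - 4 * real l ^ 2) * (j + 2)
          * (2 * j + 1) * (real m + real k + 1)
        + (real m + real l + 1) * (4 * real m + 3) * (4 * real m + 5) * (j + 1) * (j + 2))
          * bm_term l m k"
    unfolding 1 by algebra
  also have "\<dots> = (cert l m (j + 1) * (real m + real k + 1) * (j + 2)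
       - (real k - real l) * (2 * j + 1) * cert l m (j + 2)) * bm_term l m k"
    unfolding k cert_def by algebra
  finally show ?thesis .
qed

text \<open>The sum is \<open>G (k + 1) - G 0\<close>. Expressing \<open>G (k + 1)\<close> through
  \<open>bm_term l m k\<close> keeps the formula valid at \<open>k = m\<close>, where the
  denominator of \<open>G (m + 1)\<close> vanishes.\<close>

lemma sum_telescoper:
  assumes "k \<le> m"
  shows "(real m - real k + 1) * (\<Sum>i\<le>k. telescoper l m i)
    = cert l m (real m - real k + 1) * (real m + real k + 1) * bm_term l m k"
  using assms
proof (induction k)
  case 0
  \<comment> \<open>This is \<open>G 0 = 0\<close>: either \<open>l = 0\<close> or
    \<open>0 choose l\<close> is 0.\<close>
  have 1: "real l * bm_term l m 0 = 0"
    by (cases l) (simp_all add: bm_term_def)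
  have "(real m + 2) * ((real m + 1) * telescoper l m 0)
     = (real m + 2) * (cert l m (real m + 1) * (real m + 1) * bm_term l m 0)
       + (2 * real m + 1) * cert l m (real m + 2) * (real l * bm_term l m 0)"
    using telescoper_eq[of 0 m l] by (simp add: algebra_simps)
  hence "(real m + 2) * ((real m + 1) * telescoper l m 0)
     = (real m + 2) * (cert l m (real m + 1) * (real m + 1) * bm_term l m 0)"
    unfolding 1 by simp
  moreover have "real m + 2 \<noteq> 0"
    by linarith
  ultimately show ?case
    by simp
next
  case (Suc k)
  define j where "j = real m - real (Suc k)"
  have mk: "real m - real k = j + 1" "real m - real (Suc k) = j"
    by (simp_all add: j_def)
  have j0: "j \<ge> 0"
    using Suc.prems by (simp add: j_def)
  define S where "S = (\<Sum>i\<le>k. telescoper l m i)"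
  have IH: "(j + 2) * S = cert l m (j + 2) * (real m + real k + 1) * bm_term l m k"
    using Suc unfolding S_def mk by (simp add: add.assoc)
  have R: "(2 * j + 1) * (real k + 1 - real l) * bm_term l m (Suc k)
      = (j + 1) * (real m + real k + 1) * bm_term l m k"
    using bm_term_Suc_k[of k m l] Suc.prems unfolding mk by (simp add: algebra_simps)
  have T: "(j + 1) * (j + 2) * telescoper l m (Suc k)
    = (cert l m (j + 1) * (real m + real k + 2) * (j + 2)
       - (real k + 1 - real l) * (2 * j + 1) * cert l m (j + 2)) * bm_term l m (Suc k)"
    using telescoper_eq[OF Suc.prems, of l] unfolding mk by (simp add: algebra_simps)
  have "(j + 1) * (j + 2) * S
      = cert l m (j + 2) * ((2 * j + 1) * (real k + 1 - real l) * bm_term l m (Suc k))"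
    unfolding R using IH by algebra
  hence "(j + 2) * ((j + 1) * (S + telescoper l m (Suc k)))
      = (j + 2) * (cert l m (j + 1) * (real m + real k + 2) * bm_term l m (Suc k))"
    using T by algebra
  moreover have "j + 2 \<noteq> 0"
    using j0 by linarith
  ultimately have "(j + 1) * (S + telescoper l m (Suc k))
      = cert l m (j + 1) * (real m + real k + 2) * bm_term l m (Suc k)"
    by simp
  thus ?case
    unfolding mk by (simp add: S_def algebra_simps)
qed

text \<open>Summing \<open>telescoper\<close> over \<open>k \<le> m\<close> misses the terms
  \<open>k = m + 1\<close> and \<open>k = m + 2\<close> of the higher rows. These and the telescoped
  sum are all multiples of \<open>F\<close>, and their coefficients cancel by
  \<open>Z\<close>.\<close>

lemma boros_moll_recurrence:
  "4 * (real m + 2 - real l) * (real m + 1) * (real m + 2) * boros_moll l (Suc (Suc m))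
   = 2 * (real m + 1) * (8 * real m ^ 2 + 24 * real m + 19 - 4 * real l ^ 2) * boros_moll l (Suc m)
     - (real m + real l + 1) * (4 * real m + 3) * (4 * real m + 5) * boros_moll l m"
proof -
  define a where "a = 4 * (real m + 2 - real l) * (real m + 1) * (real m + 2)"
  define b where "b = 2 * (real m + 1) * (8 * real m ^ 2 + 24 * real m + 19 - 4 * real l ^ 2)"
  define c where "c = (real m + real l + 1) * (4 * real m + 3) * (4 * real m + 5)"
  define F where "F = bm_term l (Suc m) (Suc m)"
  have S: "(\<Sum>k\<le>m. telescoper l m k)
      = a * (\<Sum>k\<le>m. bm_term l (Suc (Suc m)) k) - b * (\<Sum>k\<le>m. bm_term l (Suc m) k)
        + c * (\<Sum>k\<le>m. bm_term l m k)"
    by (simp add: telescoper_def a_def b_def c_def sum.distrib sum_subtractf sum_distrib_left)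
  have "(\<Sum>k\<le>m. telescoper l m k) = cert l m 1 * ((2 * real m + 1) * bm_term l m m)"
    using sum_telescoper[of m m l] by simp
  hence H: "(\<Sum>k\<le>m. telescoper l m k) = cert l m 1 * (real m + 1 - real l) * F"
    unfolding bm_term_diag[symmetric] F_def by simp
  have D: "a * bm_term l (Suc (Suc m)) (Suc (Suc m)) = 4 * (real m + 1) * (real m + 2) * (2 * real m + 3) * F"
    using bm_term_diag[of "Suc m" l] unfolding a_def F_def by (simp add: algebra_simps) algebra
  have E: "a * bm_term l (Suc (Suc m)) (Suc m) = 2 * (real m + 2 - real l) * (real m + 1) * (2 * real m + 3) * F"
    using bm_term_Suc_m[of "Suc m" "Suc m" l] unfolding a_def F_def by (simp add: algebra_simps) algebra
  have Z: "cert l m 1 * (real m + 1 - real l) + 4 * (real m + 1) * (real m + 2) * (2 * real m + 3)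
      + 2 * (real m + 2 - real l) * (real m + 1) * (2 * real m + 3) - b = 0"
    unfolding cert_def b_def by algebra
  have "a * boros_moll l (Suc (Suc m)) - b * boros_moll l (Suc m) + c * boros_moll l m
      = (\<Sum>k\<le>m. telescoper l m k) + a * bm_term l (Suc (Suc m)) (Suc m)
        + a * bm_term l (Suc (Suc m)) (Suc (Suc m)) - b * F"
    unfolding S boros_moll_eq_sum F_def by (simp add: algebra_simps)
  also have "\<dots> = 0"
    unfolding H D E using Z by algebra
  finally show ?thesis
    unfolding a_def b_def c_def by simp
qed

section \<open>Positivity and the initial ratio\<close>

lemma boros_moll_pos:
  assumes "l \<le> m"
  shows "boros_moll l m > 0"
proof -
  have "(\<Sum>k\<le>m. bm_term l m k) > 0"
  proof (rule sum_pos2)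
    show "bm_term l m m > 0"
      using assms by (simp add: bm_term_def)
  qed (auto simp: bm_term_def)
  thus ?thesis
    by (simp add: boros_moll_eq_sum)
qed

lemma boros_moll_diag_Suc:
  "2 * (real l + 1) * boros_moll l (Suc l) = (2 * real l + 1) * (2 * real l + 3) * boros_moll l l"
proof -
  have z: "bm_term l m k = 0" if "k < l" for m k
    using that by (simp add: bm_term_def)
  have "(\<Sum>k\<le>l. bm_term l l k) = bm_term l l l"
    by (rule sum.mono_neutral_right[of "{..l}" "{l}", simplified]) (auto simp: z)
  hence 1: "boros_moll l l = bm_term l l l"
    by (simp add: boros_moll_eq_sum)
  have "(\<Sum>k\<le>l. bm_term l (Suc l) k) = bm_term l (Suc l) l"
    by (rule sum.mono_neutral_right[of "{..l}" "{l}", simplified]) (auto simp: z)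
  hence 2: "boros_moll l (Suc l) = bm_term l (Suc l) l + bm_term l (Suc l) (Suc l)"
    by (simp add: boros_moll_eq_sum)
  have "2 * (real l + 1) * bm_term l (Suc l) l = (2 * real l + 1) * bm_term l l l"
    using bm_term_Suc_m[of l l l] by simp
  moreover have "bm_term l (Suc l) (Suc l) = (2 * real l + 1) * bm_term l l l"
    using bm_term_diag[of l l] by simp
  ultimately show ?thesis
    unfolding 1 2 by (simp add: algebra_simps)
qed

section \<open>Polynomial inequalities for the lower bound\<close>

text \<open>This is what remains of \<open>ratio_bound_Suc\<close> after clearing denominators and
  removing a common factor \<open>l ^ 2\<close>.\<close>

lemma invariant_step_poly:
  fixes l m :: real
  assumes "l \<ge> 0" "m \<ge> l + 1"
  shows "m * ((4 * m ^ 2 - m) * (l ^ 2 + m) + (m - 1) * l ^ 2)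
    \<le> ((4 * m ^ 2 + m - 4 * l ^ 2) * (m - 1) + (4 * m - 1) * (l ^ 2 + m)) * (l ^ 2 + m + 1)"
proof -
  \<comment> \<open>Shifting by \<open>m = x + t + 1\<close> maps the region to
    \<open>x, t \<ge> 0\<close>, where the difference has only positive coefficients.\<close>
  define t where "t = m - l - 1"
  define x where "x = l"
  have m: "m = x + t + 1" and nonneg: "x \<ge> 0" "t \<ge> 0"
    using assms by (simp_all add: t_def x_def)
  have "((4 * m ^ 2 + m - 4 * x ^ 2) * (m - 1) + (4 * m - 1) * (x ^ 2 + m)) * (x ^ 2 + m + 1)
      - m * ((4 * m ^ 2 - m) * (x ^ 2 + m) + (m - 1) * x ^ 2)
    = 3 + 14 * t + 17 * t^2 + 6 * t^3 + 14 * x + 34 * x * t + 18 * x * t^2 + 23 * x^2 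
        + 22 * x^2 * t + x^2 * t^2 + 10 * x^3 + 2 * x^3 * t + 4 * x^4"
    (is "_ = ?p") unfolding m by algebra
  moreover have "?p \<ge> 0"
    using nonneg by simp
  ultimately show ?thesis
    unfolding x_def by linarith
qed

text \<open>
  The inequality of \<open>quadratic_pos\<close> below at \<open>Y = ratio_bound l m = N / D\<close>, cleared of denominators.
\<close>

lemma quadratic_at_invariant_poly:
  fixes l m :: real
  assumes "l \<ge> 0" "m \<ge> l + 1"
  defines "N \<equiv> (4 * m ^ 2 - m) * (l ^ 2 + m) + (m - 1) * l ^ 2" and "D \<equiv> l ^ 2 + m"
  shows "(m + 1) ^ 2 * (m ^ 2 + 1) * N ^ 2 - (8 * m ^ 2 + 8 * m + 3 - 4 * l ^ 2) * m ^ 4 * N * D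
    + (m ^ 2 - l ^ 2) * (16 * m ^ 2 - 1) * m ^ 4 * D ^ 2 > 0"
proof -
  define t where "t = m - l - 1"
  define x where "x = l"
  have l: "l = x" and m: "m = x + t + 1" and nonneg: "x \<ge> 0" "t \<ge> 0"
    using assms by (simp_all add: t_def x_def)
  have "(m + 1) ^ 2 * (m ^ 2 + 1) * N ^ 2 - (8 * m ^ 2 + 8 * m + 3 - 4 * l ^ 2) * m ^ 4 * N * D
    + (m ^ 2 - l ^ 2) * (16 * m ^ 2 - 1) * m ^ 4 * D ^ 2
    = 30 + 229 * t + 753 * t^2 + 1391 * t^3 + 1576 * t^4 + 1119 * t^5 + 485 * t^6 + 117 * t^7 
        + 12 * t^8 + 229 * x + 1506 * x * t + 4173 * x * t^2 + 6304 * x * t^3 + 5595 * x * t^4 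
        + 2910 * x * t^5 + 819 * x * t^6 + 96 * x * t^7 + 810 * x^2 + 4578 * x^2 * t 
        + 10632 * x^2 * t^2 + 13006 * x^2 * t^3 + 8890 * x^2 * t^4 + 3286 * x^2 * t^5 
        + 564 * x^2 * t^6 + 26 * x^2 * t^7 + 1796 * x^3 + 8656 * x^3 * t + 16638 * x^3 * t^2 
        + 16160 * x^3 * t^3 + 8240 * x^3 * t^4 + 2040 * x^3 * t^5 + 182 * x^3 * t^6 
        + 2776 * x^4 + 11207 * x^4 * t + 17386 * x^4 * t^2 + 12907 * x^4 * t^3 
        + 4599 * x^4 * t^4 + 658 * x^4 * t^5 + 15 * x^4 * t^6 + 3099 * x^5 + 10212 * x^5 * t 
        + 12313 * x^5 * t^2 + 6588 * x^5 * t^3 + 1470 * x^5 * t^4 + 90 * x^5 * t^5 + 2518 * x^6 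
        + 6518 * x^6 * t + 5772 * x^6 * t^2 + 2018 * x^6 * t^3 + 222 * x^6 * t^4 + 1456 * x^7 
        + 2784 * x^7 * t + 1630 * x^7 * t^2 + 288 * x^7 * t^3 + 561 * x^8 + 706 * x^8 * t 
        + 207 * x^8 * t^2 + 126 * x^9 + 78 * x^9 * t + 12 * x^10"
    (is "_ = ?p") unfolding N_def D_def l m by algebra
  moreover have "?p > 0"
    using nonneg by (intro add_pos_nonneg) simp_all
  ultimately show ?thesis
    by simp
qed

section \<open>The scaled ratio and its lower bound\<close>

text \<open>The weight \<open>2 * (m - l) * m\<close> absorbs the leading coefficient of the
  recurrence, so that \<open>scaled_ratio_Suc\<close> has polynomial coefficients.\<close>

definition scaled_ratio :: "nat \<Rightarrow> nat \<Rightarrow> real" where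
  "scaled_ratio l m
     = 2 * (real m - real l) * real m * boros_moll l m / boros_moll l (m - 1)"

lemma scaled_ratio_Suc:
  assumes "l < m"
  shows "scaled_ratio l (Suc m) = 8 * real m ^ 2 + 8 * real m + 3 - 4 * real l ^ 2
    - (real m ^ 2 - real l ^ 2) * (16 * real m ^ 2 - 1) / scaled_ratio l m"
proof -
  obtain n where m: "m = Suc n"
    using assms by (cases m) auto
  define a b c where "a = boros_moll l n" and "b = boros_moll l m" and "c = boros_moll l (Suc m)"
  have pos: "a > 0" "b > 0" "c > 0"
    using assms by (auto simp: a_def b_def c_def m intro!: boros_moll_pos)
  have M: "real m > 0" "real m - real l > 0"
    using assms by auto
  \<comment> \<open>The recurrence at \<open>n = m - 1\<close>, where
    \<open>(4 * n + 3) * (4 * n + 5) = 16 * m ^ 2 - 1\<close>.\<close>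
  have rec: "4 * (real m + 1 - real l) * real m * (real m + 1) * c
     = 2 * real m * (8 * real m ^ 2 + 8 * real m + 3 - 4 * real l ^ 2) * b
     - (real m + real l) * (16 * real m ^ 2 - 1) * a"
    using boros_moll_recurrence[of n l] unfolding a_def b_def c_def m
    by (simp add: algebra_simps power2_eq_square)
  have Y: "scaled_ratio l m = 2 * (real m - real l) * real m * b / a"
    by (simp add: scaled_ratio_def a_def b_def m)
  have "(real m ^ 2 - real l ^ 2) * (16 * real m ^ 2 - 1) / scaled_ratio l m
      = (real m - real l) * ((real m + real l) * (16 * real m ^ 2 - 1) * a)
        / ((real m - real l) * (2 * real m * b))"
    unfolding Y by (simp add: power2_eq_square algebra_simps)
  also have "\<dots> = (real m + real l) * (16 * real m ^ 2 - 1) * a / (2 * real m * b)"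
    using M by (intro mult_divide_mult_cancel_left) simp
  finally have B: "(real m ^ 2 - real l ^ 2) * (16 * real m ^ 2 - 1) / scaled_ratio l m
    = (real m + real l) * (16 * real m ^ 2 - 1) * a / (2 * real m * b)" .
  have "scaled_ratio l (Suc m) = 4 * (real m + 1 - real l) * real m * (real m + 1) * c / (2 * real m * b)"
    using M pos by (simp add: scaled_ratio_def b_def c_def field_simps)
  also have "\<dots> = 8 * real m ^ 2 + 8 * real m + 3 - 4 * real l ^ 2
      - (real m + real l) * (16 * real m ^ 2 - 1) * a / (2 * real m * b)"
    unfolding rec using M pos by (simp add: diff_divide_distrib)
  finally show ?thesis
    unfolding B .
qed

text \<open>
  Writing \<open>Y\<^sub>m = 4 m\<^sup>2 - m + X\<close>, the correction \<open>X\<close> behaves like \<open>m - 1 - 3 m\<^sup>2 / (4 l\<^sup>2)\<close> when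
  \<open>m\<close> is small compared with \<open>l\<^sup>2\<close>; the rational function below is a slightly smaller
  minorant that the recurrence preserves.
\<close>

definition ratio_bound :: "real \<Rightarrow> real \<Rightarrow> real" where
  "ratio_bound l m = 4 * m ^ 2 - m + (m - 1) * l ^ 2 / (l ^ 2 + m)"

lemma ratio_bound_pos:
  assumes "m \<ge> 1"
  shows "ratio_bound l m > 0"
proof -
  have "4 * m ^ 2 - m > 0"
    using assms mult_left_mono[of 1 m m] by (simp add: power2_eq_square)
  moreover have "(m - 1) * l ^ 2 / (l ^ 2 + m) \<ge> 0"
    using assms by simp
  ultimately show ?thesis
    by (simp add: ratio_bound_def)
qed

text \<open>The right-hand side is the map of \<open>scaled_ratio_Suc\<close> applied to the bound
  itself. After subtracting \<open>4 * m ^ 2 + 7 * m + 3\<close>, both sides are multiples of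
  \<open>l ^ 2\<close>.\<close>

lemma ratio_bound_Suc:
  fixes l m :: real
  assumes "l \<ge> 0" "m \<ge> l + 1"
  shows "ratio_bound l (m + 1) \<le> 8 * m ^ 2 + 8 * m + 3 - 4 * l ^ 2
    - (m ^ 2 - l ^ 2) * (16 * m ^ 2 - 1) / ratio_bound l m"
proof -
  define D where "D = l ^ 2 + m"
  define N where "N = (4 * m ^ 2 - m) * D + (m - 1) * l ^ 2"
  have D: "D > 0" "D + 1 > 0"
    using assms by (auto simp: D_def add_nonneg_pos add_pos_pos)
  have r: "ratio_bound l m = N / D"
    using D unfolding ratio_bound_def N_def D_def[symmetric] by (simp add: field_simps)
  have N: "N > 0"
    using ratio_bound_pos[of m l] assms D by (simp add: r zero_less_divide_iff)
  define M where "M = (4 * m ^ 2 + m - 4 * l ^ 2) * (m - 1) + (4 * m - 1) * D"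
  have "l ^ 2 * (m * N) \<le> l ^ 2 * (M * (D + 1))"
    using invariant_step_poly[OF assms] unfolding M_def N_def D_def
    by (intro mult_left_mono) (simp_all add: add.assoc)
  hence "m * l ^ 2 / (D + 1) \<le> l ^ 2 * M / N"
    using D N by (simp add: divide_simps mult_ac)
  also have "l ^ 2 * M / N = 4 * m ^ 2 + m - 4 * l ^ 2 - (m ^ 2 - l ^ 2) * (16 * m ^ 2 - 1) * D / N"
  proof -
    \<comment> \<open>Since
      \<open>(4 * m ^ 2 + m) * (4 * m ^ 2 - m) = m ^ 2 * (16 * m ^ 2 - 1)\<close>, the leading parts
      cancel and a multiple of \<open>l ^ 2\<close> is left.\<close>
    have "l ^ 2 * M = (4 * m ^ 2 + m - 4 * l ^ 2) * N - (m ^ 2 - l ^ 2) * (16 * m ^ 2 - 1) * D"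
      unfolding M_def N_def by algebra
    thus ?thesis
      using N by (simp add: diff_divide_distrib)
  qed
  finally have "m * l ^ 2 / (D + 1)
    \<le> 4 * m ^ 2 + m - 4 * l ^ 2 - (m ^ 2 - l ^ 2) * (16 * m ^ 2 - 1) * D / N" .
  moreover have "ratio_bound l (m + 1) = 4 * m ^ 2 + 7 * m + 3 + m * l ^ 2 / (D + 1)"
    by (simp add: ratio_bound_def D_def add.assoc) algebra
  ultimately show ?thesis
    by (simp add: r)
qed

lemma scaled_ratio_ge:
  assumes "l < m"
  shows "ratio_bound (real l) (real m) \<le> scaled_ratio l m"
proof -
  have "Suc l \<le> m"
    using assms by simp
  thus ?thesis
  proof (induction m rule: dec_induct)
    case base
    have "scaled_ratio l (Suc l) = (2 * real l + 1) * (2 * real l + 3)"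
      using boros_moll_diag_Suc[of l] boros_moll_pos[of l l]
      by (simp add: scaled_ratio_def field_simps)
    \<comment> \<open>The first summand is the exact ratio at \<open>m = l + 1\<close>; the bracket
      is at most 0.\<close>
    moreover have "ratio_bound (real l) (real (Suc l))
        = (2 * real l + 1) * (2 * real l + 3) + (real l * real l ^ 2 / (real l ^ 2 + real l + 1) - real l)"
      by (simp add: ratio_bound_def algebra_simps power2_eq_square)
    moreover have "real l ^ 2 + real l + 1 > 0"
      by (simp add: add_nonneg_pos)
    hence "real l * real l ^ 2 / (real l ^ 2 + real l + 1) \<le> real l"
      by (simp add: pos_divide_le_eq algebra_simps)
    ultimately show ?case
      by linarith
  next
    case (step m)
    define B where "B = (real m ^ 2 - real l ^ 2) * (16 * real m ^ 2 - 1)"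
    have m: "real m \<ge> real l + 1" "real m \<ge> 1"
      using step.hyps by simp_all
    have "real m ^ 2 \<ge> 1"
      using m(2) by simp
    moreover have "real m ^ 2 \<ge> real l ^ 2"
      using m(1) by (intro power_mono) simp_all
    ultimately have B: "B \<ge> 0"
      unfolding B_def by simp
    have "B / scaled_ratio l m \<le> B / ratio_bound l m"
      using B ratio_bound_pos[OF m(2), of l] step.IH by (intro divide_left_mono) simp_all
    moreover have "ratio_bound (real l) (real (Suc m)) \<le> 8 * real m ^ 2 + 8 * real m + 3 - 4 * real l ^ 2
        - B / ratio_bound l m"
      using ratio_bound_Suc[OF _ m(1)] unfolding B_def by (simp add: add.commute)
    moreover have "scaled_ratio l (Suc m) = 8 * real m ^ 2 + 8 * real m + 3 - 4 * real l ^ 2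
        - B / scaled_ratio l m"
      unfolding B_def using step.hyps by (intro scaled_ratio_Suc) simp
    ultimately show ?case
      by linarith
  qed
qed

section \<open>The quadratic inequality and the conclusion\<close>

text \<open>The values at \<open>Y\<close> and at \<open>r = ratio_bound l m\<close> differ by
  \<open>(Y - r) * (K * (Y + r) - A)\<close>, so it suffices that the value at \<open>r\<close> is
  positive and \<open>A \<le> 2 * K * r\<close>.\<close>

lemma quadratic_pos:
  fixes l m Y :: real
  assumes "l \<ge> 0" "m \<ge> l + 1" "Y \<ge> ratio_bound l m"
  shows "(m + 1) ^ 2 * (m ^ 2 + 1) * Y ^ 2 - (8 * m ^ 2 + 8 * m + 3 - 4 * l ^ 2) * m ^ 4 * Y
    + (m ^ 2 - l ^ 2) * (16 * m ^ 2 - 1) * m ^ 4 > 0"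
proof -
  define K where "K = (m + 1) ^ 2 * (m ^ 2 + 1)"
  define A where "A = (8 * m ^ 2 + 8 * m + 3 - 4 * l ^ 2) * m ^ 4"
  define B where "B = (m ^ 2 - l ^ 2) * (16 * m ^ 2 - 1) * m ^ 4"
  define r where "r = ratio_bound l m"
  define D where "D = l ^ 2 + m"
  define N where "N = (4 * m ^ 2 - m) * D + (m - 1) * l ^ 2"
  have m: "m \<ge> 1"
    using assms by simp
  have D: "D > 0"
    using assms by (simp add: D_def add_nonneg_pos)
  have rD: "r * D = N"
    using D unfolding r_def ratio_bound_def N_def D_def[symmetric] by (simp add: field_simps)
  have "D ^ 2 * (K * r ^ 2 - A * r + B) = K * (r * D) ^ 2 - A * (r * D) * D + B * D ^ 2"
    by algebra
  also have "\<dots> > 0"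
    using quadratic_at_invariant_poly[OF assms(1,2)] unfolding rD unfolding K_def A_def B_def N_def D_def .
  finally have at_r: "K * r ^ 2 - A * r + B > 0"
    using D by (simp add: zero_less_mult_iff)
  \<comment> \<open>Dropping \<open>- 4 * l ^ 2\<close> from \<open>A\<close> and the correction
    term from \<open>r\<close> reduces \<open>A \<le> 2 * K * r\<close> to an inequality in
    \<open>m\<close> alone.\<close>
  have "2 * K * (4 * m ^ 2 - m) - (8 * m ^ 2 + 8 * m + 3) * m ^ 4
      = 6 * m ^ 5 + 9 * m ^ 4 + 12 * m ^ 3 + 2 * m ^ 2 + 2 * m * (m - 1)"
    unfolding K_def by algebra
  also have "\<dots> \<ge> 0"
    using m by simp
  finally have "(8 * m ^ 2 + 8 * m + 3) * m ^ 4 \<le> 2 * K * (4 * m ^ 2 - m)"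
    by simp
  moreover have "A \<le> (8 * m ^ 2 + 8 * m + 3) * m ^ 4"
    unfolding A_def by (intro mult_right_mono) simp_all
  moreover have "4 * m ^ 2 - m \<le> r"
    using m D unfolding r_def ratio_bound_def D_def[symmetric] by simp
  hence "2 * K * (4 * m ^ 2 - m) \<le> 2 * K * r"
    by (intro mult_left_mono) (simp_all add: K_def)
  moreover have "2 * K * r \<le> K * (Y + r)"
    using assms(3) mult_left_mono[of r Y K] by (simp add: K_def r_def algebra_simps)
  ultimately have "A \<le> K * (Y + r)"
    by linarith
  hence "(Y - r) * (K * (Y + r) - A) \<ge> 0"
    using assms(3) by (simp add: r_def)
  moreover have "K * Y ^ 2 - A * Y + B = (K * r ^ 2 - A * r + B) + (Y - r) * (K * (Y + r) - A)"
    by algebra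
  ultimately show ?thesis
    using at_r unfolding K_def[symmetric] A_def[symmetric] B_def[symmetric] by linarith
qed

theorem theorem3p2:
  fixes l m :: nat
  assumes "m \<ge> l + 1"
  shows "(boros_moll l m)\<^sup>2 / (boros_moll l (m - 1) * boros_moll l (m + 1))
    > ((real m - real l + 1) * real m ^ 3)
      / ((real m - real l) * (real m + 1) * (real m ^ 2 + 1))"
proof -
  define a b c where "a = boros_moll l (m - 1)" and "b = boros_moll l m"
    and "c = boros_moll l (m + 1)"
  have pos: "a > 0" "b > 0" "c > 0"
    using assms by (auto simp: a_def b_def c_def intro!: boros_moll_pos)
  have m: "real m \<ge> real l + 1" "real m > 0" "real m - real l > 0" "l < m"
    using assms by auto
  define Y Z where "Y = scaled_ratio l m" and "Z = scaled_ratio l (Suc m)"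
  \<comment> \<open>Together with \<open>Z\<close> this makes \<open>Y / Z\<close> equal to
    \<open>b ^ 2 / (a * c)\<close> times an explicit rational factor, so the claim becomes an
    inequality between \<open>Y\<close> and \<open>Z\<close>.\<close>
  have Y: "Y * a = 2 * (real m - real l) * real m * b"
    using pos by (simp add: Y_def scaled_ratio_def a_def b_def)
  have Z: "Z * b = 2 * (real m - real l + 1) * (real m + 1) * c"
    using pos by (simp add: Z_def scaled_ratio_def b_def c_def field_simps)
  have Y_ge: "Y \<ge> ratio_bound l m"
    unfolding Y_def using scaled_ratio_ge[OF m(4)] .
  have Y_pos: "Y > 0"
    using Y_ge ratio_bound_pos[of "real m" "real l"] m(1) by linarith
  have "Z = 8 * real m ^ 2 + 8 * real m + 3 - 4 * real l ^ 2
      - (real m ^ 2 - real l ^ 2) * (16 * real m ^ 2 - 1) / Y"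
    unfolding Y_def Z_def by (rule scaled_ratio_Suc[OF m(4)])
  hence "Z * Y = (8 * real m ^ 2 + 8 * real m + 3 - 4 * real l ^ 2) * Y
      - (real m ^ 2 - real l ^ 2) * (16 * real m ^ 2 - 1)"
    using Y_pos by (simp add: field_simps)
  \<comment> \<open>Multiplying by \<open>Y > 0\<close> eliminates \<open>Z\<close> and produces the
    quadratic of \<open>quadratic_pos\<close>.\<close>
  hence "Y * ((real m + 1) ^ 2 * (real m ^ 2 + 1) * Y - Z * real m ^ 4)
      = (real m + 1) ^ 2 * (real m ^ 2 + 1) * Y ^ 2
        - (8 * real m ^ 2 + 8 * real m + 3 - 4 * real l ^ 2) * real m ^ 4 * Y
        + (real m ^ 2 - real l ^ 2) * (16 * real m ^ 2 - 1) * real m ^ 4"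
    by algebra
  also have "\<dots> > 0"
    using quadratic_pos[OF _ m(1) Y_ge] by simp
  finally have "Z * real m ^ 4 < (real m + 1) ^ 2 * (real m ^ 2 + 1) * Y"
    using Y_pos by (simp add: zero_less_mult_iff)
  hence "a * b * (Z * real m ^ 4) < a * b * ((real m + 1) ^ 2 * (real m ^ 2 + 1) * Y)"
    using pos by simp
  hence "a * real m ^ 4 * (Z * b) < b * (real m + 1) ^ 2 * (real m ^ 2 + 1) * (Y * a)"
    by (simp only: mult_ac)
  \<comment> \<open>Substituting for \<open>Z * b\<close> and \<open>Y * a\<close> leaves the common
    positive factor \<open>2 * m * (m + 1)\<close>.\<close>
  hence "(2 * real m * (real m + 1)) * ((real m - real l + 1) * real m ^ 3 * (a * c))
      < (2 * real m * (real m + 1)) * (b ^ 2 * ((real m - real l) * (real m + 1) * (real m ^ 2 + 1)))"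
    unfolding Y Z by (simp only: power2_eq_square power3_eq_cube power4_eq_xxxx mult_ac)
  hence "(real m - real l + 1) * real m ^ 3 * (a * c)
      < b ^ 2 * ((real m - real l) * (real m + 1) * (real m ^ 2 + 1))"
    by (rule mult_left_less_imp_less) simp
  thus ?thesis
    unfolding a_def[symmetric] b_def[symmetric] c_def[symmetric] using pos m(2,3)
    by (simp add: divide_less_eq less_divide_eq add_pos_pos mult.commute)
qed

end
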